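(* For every $f \in L^{\infty}([1,\infty))$, $$\sup_{\psi \in \mathcal{C}} \psi(f) = \overline{P}(f).$$
   Context: $L^{\infty}([1,\infty))$ is the space of real-valued essentially bounded measurable functions on $[1,\infty)$ (Lebesgue measure), and $L^{\infty}([1,\infty))^*$ is its dual. For $f\in L^{\infty}([1,\infty))$ put $M(f)=\lim_{x\to\infty}\frac1x\int_1^x f(t)\,dt$ whenever this limit exists. $E_0$ is the subspace of all $f\in L^\infty([1,\infty))$ for which $M(f)$ exists and equals $0$. $\mathcal{C}$ is the set of positive linear functionals of norm $1$ on $L^{\infty}([1,\infty))$ that vanish on $E_0$ (equivalently, normalized positive linear functionals extending $M$). The sublinear functional $\overline{P}$ is $$\overline{P}(f)=\lim_{\theta\to1^+}\limsup_{x\to\infty}\frac{1}{\theta x-x}\int_x^{\theta x}f(t)\,dt .$$ *)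

theory Defs
  imports "HOL-Analysis.Analysis" "HOL-Probability.Essential_Supremum"
begin

section \<open>The normed space \<open>L\<^sup>\<infinity>([1,\<infinity>))\<close>\<close>

abbreviation leb1 :: "real measure"
  where "leb1 \<equiv> lebesgue_on {1..}"

definition ess_norm :: "(real \<Rightarrow> real) \<Rightarrow> ereal"
  where "ess_norm f = esssup leb1 (\<lambda>x. ereal \<bar>f x\<bar>)"

definition ess_bounded :: "(real \<Rightarrow> real) \<Rightarrow> bool"
  where "ess_bounded f \<longleftrightarrow> f \<in> borel_measurable leb1 \<and> ess_norm f < \<infinity>"

definition linf_rel :: "(real \<Rightarrow> real) \<Rightarrow> (real \<Rightarrow> real) \<Rightarrow> bool"
  where "linf_rel f g \<longleftrightarrow> ess_bounded f \<and> ess_bounded g \<and> (AE x in leb1. f x = g x)"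

lemma ess_bounded_measurable: "ess_bounded f \<Longrightarrow> f \<in> borel_measurable leb1"
  by (simp add: ess_bounded_def)

lemma ess_norm_AE:
  "AE x in leb1. ereal \<bar>f x\<bar> \<le> ess_norm f"
  unfolding ess_norm_def by (rule esssup_AE)

lemma ess_norm_least:
  assumes "f \<in> borel_measurable leb1" "AE x in leb1. \<bar>f x\<bar> \<le> c"
  shows "ess_norm f \<le> ereal c"
proof -
  have "(\<lambda>x. ereal \<bar>f x\<bar>) \<in> borel_measurable leb1" using assms(1) by measurable
  then show ?thesis
    unfolding ess_norm_def by (rule esssup_I) (use assms(2) in simp)
qed

lemma leb1_not_null: "emeasure leb1 (space leb1) \<noteq> 0"
proof
  assume "emeasure leb1 (space leb1) = 0"
  then have "emeasure lebesgue {1::real..} = 0"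
    by (simp add: emeasure_restrict_space)
  moreover have "emeasure lebesgue {1..2::real} \<le> emeasure lebesgue {1::real..}"
    by (rule emeasure_mono) auto
  ultimately show False by simp
qed

lemma ess_norm_nonneg: "0 \<le> ess_norm f"
proof (rule ccontr)
  assume "\<not> 0 \<le> ess_norm f"
  then have neg: "ess_norm f < 0" by simp
  have "AE x in leb1. False"
    using ess_norm_AE[of f]
  proof eventually_elim
    case (elim x)
    with neg have "ereal \<bar>f x\<bar> < 0" by (rule le_less_trans[rotated])
    then show False by simp
  qed
  then have "ae_filter leb1 = bot" using eventually_False by blast
  then show False using leb1_not_null by (simp add: ae_filter_eq_bot_iff)
qed

lemma ess_bounded_norm:
  assumes "ess_bounded f"
  shows "ess_norm f = ereal (real_of_ereal (ess_norm f))"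
  using assms ess_norm_nonneg[of f] by (cases "ess_norm f") (auto simp: ess_bounded_def)

lemma ess_bounded_AE:
  assumes "ess_bounded f"
  shows "AE x in leb1. \<bar>f x\<bar> \<le> real_of_ereal (ess_norm f)"
  using ess_norm_AE[of f] by (subst (asm) ess_bounded_norm[OF assms]) simp

lemma ess_bounded_least:
  assumes "ess_bounded f" "AE x in leb1. \<bar>f x\<bar> \<le> c"
  shows "real_of_ereal (ess_norm f) \<le> c"
  using ess_norm_least[OF ess_bounded_measurable[OF assms(1)] assms(2)]
  by (subst (asm) ess_bounded_norm[OF assms(1)]) simp

lemma ess_boundedI:
  assumes "f \<in> borel_measurable leb1" "AE x in leb1. \<bar>f x\<bar> \<le> c"
  shows "ess_bounded f"
  unfolding ess_bounded_def using assms ess_norm_least[OF assms] by auto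

lemma ess_bounded_add:
  assumes "ess_bounded f" "ess_bounded g" shows "ess_bounded (\<lambda>x. f x + g x)"
proof (rule ess_boundedI)
  show "(\<lambda>x. f x + g x) \<in> borel_measurable leb1"
    using assms[THEN ess_bounded_measurable] by measurable
  show "AE x in leb1. \<bar>f x + g x\<bar> \<le> real_of_ereal (ess_norm f) + real_of_ereal (ess_norm g)"
    using ess_bounded_AE[OF assms(1)] ess_bounded_AE[OF assms(2)] by eventually_elim linarith
qed

lemma ess_bounded_scale:
  assumes "ess_bounded f" shows "ess_bounded (\<lambda>x. a * f x)"
proof (rule ess_boundedI)
  show "(\<lambda>x. a * f x) \<in> borel_measurable leb1"
    using assms[THEN ess_bounded_measurable] by measurable
  show "AE x in leb1. \<bar>a * f x\<bar> \<le> \<bar>a\<bar> * real_of_ereal (ess_norm f)"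
    using ess_bounded_AE[OF assms] by eventually_elim (simp add: abs_mult mult_left_mono)
qed

lemma ess_bounded_zero: "ess_bounded (\<lambda>x. 0)"
  by (rule ess_boundedI[where c=0]) auto

lemma ess_norm_cong:
  assumes "linf_rel f g" shows "ess_norm f = ess_norm g"
proof -
  have *: "ess_norm f \<le> ess_norm g" if "linf_rel f g" for f g
  proof -
    have fg: "ess_bounded f" "ess_bounded g" "AE x in leb1. f x = g x"
      using that by (simp_all add: linf_rel_def)
    have "AE x in leb1. \<bar>f x\<bar> \<le> real_of_ereal (ess_norm g)"
      using ess_bounded_AE[OF fg(2)] fg(3) by eventually_elim simp
    from ess_norm_least[OF ess_bounded_measurable[OF fg(1)] this] show ?thesis
      by (simp flip: ess_bounded_norm[OF fg(2)])
  qed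
  have "linf_rel g f" using assms by (auto simp: linf_rel_def elim: eventually_mono)
  with assms * show ?thesis by (intro antisym)
qed

quotient_type linf = "real \<Rightarrow> real" / partial: linf_rel
proof (rule part_equivpI)
  show "\<exists>f. linf_rel f f" using ess_bounded_zero by (auto simp: linf_rel_def)
  show "symp linf_rel" by (auto simp: symp_def linf_rel_def elim: eventually_mono)
  show "transp linf_rel"
    by (auto simp: transp_def linf_rel_def elim: eventually_elim2)
qed

instantiation linf :: real_normed_vector
begin

lift_definition zero_linf :: linf is "\<lambda>x. 0"
  by (simp add: linf_rel_def ess_bounded_zero)

lift_definition plus_linf :: "linf \<Rightarrow> linf \<Rightarrow> linf" is "\<lambda>f g x. f x + g x"
  by (auto simp: linf_rel_def ess_bounded_add elim: eventually_elim2)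

lift_definition scaleR_linf :: "real \<Rightarrow> linf \<Rightarrow> linf" is "\<lambda>a f x. a * f x"
  by (auto simp: linf_rel_def ess_bounded_scale elim: eventually_mono)

lift_definition norm_linf :: "linf \<Rightarrow> real" is "\<lambda>f. real_of_ereal (ess_norm f)"
  by (simp add: ess_norm_cong)

definition uminus_linf :: "linf \<Rightarrow> linf"
  where "uminus_linf f = (-1) *\<^sub>R f"

definition minus_linf :: "linf \<Rightarrow> linf \<Rightarrow> linf"
  where "minus_linf f g = f + - g"

definition sgn_linf :: "linf \<Rightarrow> linf"
  where "sgn_linf f = inverse (norm f) *\<^sub>R f"

definition dist_linf :: "linf \<Rightarrow> linf \<Rightarrow> real"
  where "dist_linf f g = norm (f - g)"

definition uniformity_linf :: "(linf \<times> linf) filter"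
  where "uniformity_linf = (INF e\<in>{0<..}. principal {(f, g). dist f g < e})"

definition open_linf :: "linf set \<Rightarrow> bool"
  where "open_linf U \<longleftrightarrow> (\<forall>f\<in>U. \<forall>\<^sub>F (f', g) in uniformity. f' = f \<longrightarrow> g \<in> U)"

instance
proof
  fix f g h :: linf and a b :: real
  show "f + g + h = f + (g + h)"
    by transfer (auto simp: linf_rel_def intro!: ess_bounded_add)
  show "f + g = g + f"
    by transfer (auto simp: linf_rel_def intro!: ess_bounded_add)
  show "0 + f = f"
    by transfer (auto simp: linf_rel_def)
  show "- f + f = 0"
    unfolding uminus_linf_def
    by transfer (auto simp: linf_rel_def ess_bounded_zero)
  show "f - g = f + - g" by (rule minus_linf_def)
  show "a *\<^sub>R (f + g) = a *\<^sub>R f + a *\<^sub>R g"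
    by transfer (auto simp: linf_rel_def distrib_left intro!: ess_bounded_add ess_bounded_scale)
  show "(a + b) *\<^sub>R f = a *\<^sub>R f + b *\<^sub>R f"
    by transfer (auto simp: linf_rel_def distrib_right intro!: ess_bounded_add ess_bounded_scale)
  show "a *\<^sub>R b *\<^sub>R f = (a * b) *\<^sub>R f"
    by transfer (auto simp: linf_rel_def mult.assoc[symmetric] intro!: ess_bounded_scale)
  show "1 *\<^sub>R f = f"
    by transfer (auto simp: linf_rel_def)
  show "dist f g = norm (f - g)" by (rule dist_linf_def)
  show "sgn f = inverse (norm f) *\<^sub>R f" by (rule sgn_linf_def)
  show "uniformity = (INF e\<in>{0<..}. principal {(f :: linf, g). dist f g < e})"
    by (rule uniformity_linf_def)
  fix U :: "linf set"
  show "open U \<longleftrightarrow> (\<forall>f\<in>U. \<forall>\<^sub>F (f', g) in uniformity. f' = f \<longrightarrow> g \<in> U)"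
    by (rule open_linf_def)
next
  fix f g :: linf and a :: real
  show "norm f = 0 \<longleftrightarrow> f = 0"
  proof transfer
    fix f assume "linf_rel f f"
    then have f: "ess_bounded f" by (simp add: linf_rel_def)
    show "real_of_ereal (ess_norm f) = 0 \<longleftrightarrow> linf_rel f (\<lambda>x. 0)"
    proof
      assume "real_of_ereal (ess_norm f) = 0"
      with ess_bounded_AE[OF f] show "linf_rel f (\<lambda>x. 0)"
        by (auto simp: linf_rel_def f ess_bounded_zero)
    next
      assume "linf_rel f (\<lambda>x. 0)"
      then have "real_of_ereal (ess_norm f) \<le> 0"
        by (intro ess_bounded_least[OF f]) (auto simp: linf_rel_def elim: eventually_mono)
      with ess_norm_nonneg[of f] show "real_of_ereal (ess_norm f) = 0"
        by (simp add: antisym real_of_ereal_pos)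
    qed
  qed
  show "norm (f + g) \<le> norm f + norm g"
  proof transfer
    fix f g assume "linf_rel f f" "linf_rel g g"
    then have fg: "ess_bounded f" "ess_bounded g" by (simp_all add: linf_rel_def)
    show "real_of_ereal (ess_norm (\<lambda>x. f x + g x))
        \<le> real_of_ereal (ess_norm f) + real_of_ereal (ess_norm g)"
    proof (rule ess_bounded_least[OF ess_bounded_add[OF fg]])
      show "AE x in leb1. \<bar>f x + g x\<bar> \<le> real_of_ereal (ess_norm f) + real_of_ereal (ess_norm g)"
        using ess_bounded_AE[OF fg(1)] ess_bounded_AE[OF fg(2)] by eventually_elim linarith
    qed
  qed
  show "norm (a *\<^sub>R f) = \<bar>a\<bar> * norm f"
  proof transfer
    fix a :: real and f assume "linf_rel f f"
    then have f: "ess_bounded f" by (simp add: linf_rel_def)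
    have le: "real_of_ereal (ess_norm (\<lambda>x. c * g x)) \<le> \<bar>c\<bar> * real_of_ereal (ess_norm g)"
      if "ess_bounded g" for c g
    proof (rule ess_bounded_least[OF ess_bounded_scale[OF that]])
      show "AE x in leb1. \<bar>c * g x\<bar> \<le> \<bar>c\<bar> * real_of_ereal (ess_norm g)"
        using ess_bounded_AE[OF that] by eventually_elim (simp add: abs_mult mult_left_mono)
    qed
    show "real_of_ereal (ess_norm (\<lambda>x. a * f x)) = \<bar>a\<bar> * real_of_ereal (ess_norm f)"
    proof (cases "a = 0")
      case True
      with le[OF f, of 0] ess_norm_nonneg[of "\<lambda>x. 0"] show ?thesis
        by (simp add: antisym real_of_ereal_pos)
    next
      case False
      have "real_of_ereal (ess_norm f) \<le> \<bar>1 / a\<bar> * real_of_ereal (ess_norm (\<lambda>x. a * f x))"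
        using le[OF ess_bounded_scale[OF f, of a], of "1 / a"] False by simp
      with False have "\<bar>a\<bar> * real_of_ereal (ess_norm f) \<le> real_of_ereal (ess_norm (\<lambda>x. a * f x))"
        by (simp add: field_simps)
      with le[OF f, of a] show ?thesis by simp
    qed
  qed
qed

end

section \<open>Order, integrals and means\<close>

lift_definition linf_nonneg :: "linf \<Rightarrow> bool" is "\<lambda>f. AE x in leb1. 0 \<le> f x"
  by (auto simp: linf_rel_def elim: eventually_elim2)

lemma set_integral_linf_rel:
  assumes "linf_rel f g"
  shows "(LINT t:{a..b}|leb1. f t) = (LINT t:{a..b}|leb1. g t)"
proof -
  have [measurable]: "f \<in> borel_measurable leb1" "g \<in> borel_measurable leb1"
    and AE: "AE x in leb1. f x = g x"
    using assms by (simp_all add: linf_rel_def ess_bounded_measurable)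
  have [measurable]: "indicator {a..b} \<in> borel_measurable leb1"
    by (intro measurable_restrict_space1 borel_measurable_indicator) simp
  show ?thesis
    unfolding set_lebesgue_integral_def
    by (rule integral_cong_AE) (use AE in \<open>auto elim: eventually_mono\<close>)
qed

lift_definition linf_integral :: "linf \<Rightarrow> real \<Rightarrow> real \<Rightarrow> real"
  is "\<lambda>f a b. LINT t:{a..b}|leb1. f t"
  by (intro ext) (rule set_integral_linf_rel)

definition has_mean :: "linf \<Rightarrow> real \<Rightarrow> bool"
  where "has_mean f m \<longleftrightarrow> ((\<lambda>x. 1 / x * linf_integral f 1 x) \<longlongrightarrow> m) at_top"

definition E0 :: "linf set"
  where "E0 = {f. has_mean f 0}"

text \<open>The dual of \<open>L\<^sup>\<infinity>([1,\<infinity>))\<close> is the type of bounded linear functionals with the operator norm.\<close>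

definition extended_means :: "(linf \<Rightarrow>\<^sub>L real) set"
  where "extended_means = {\<psi>. (\<forall>f. linf_nonneg f \<longrightarrow> 0 \<le> blinfun_apply \<psi> f) \<and> norm \<psi> = 1 \<and>
    (\<forall>f\<in>E0. blinfun_apply \<psi> f = 0)}"

text \<open>The inner upper limit is taken in \<^typ>\<open>ereal\<close>, where it always exists (\<^typ>\<open>real\<close> is not
  a complete lattice); it is finite, since the averages are bounded by \<open>norm f\<close>.\<close>

definition P_upper :: "linf \<Rightarrow> ereal"
  where "P_upper f = Lim (at_right 1)
    (\<lambda>\<theta>. Limsup at_top (\<lambda>x. ereal (1 / (\<theta> * x - x) * linf_integral f x (\<theta> * x))))"

end

(* Write S for the supremum and P_theta for the upper limit of the averages over [x, theta x].

   P_theta f <= S for every theta > 1: a limit, along a suitable filter at infinity, of the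
   functionals g |-> (average of g over [x, theta x]) is an extended mean, and it can be chosen
   with value at f as close to P_theta f as desired.

   S <= liminf P_theta f as theta -> 1+: if P_theta f < c for theta arbitrarily close to 1, put
   h = f - c and H(x) = int_1^x h. Then H(theta x) <= H(x) for large x, which forces H to exceed
   its running minimum by o(x) only. The running minimum over the integers is the primitive of a
   step function -g <= 0, so h + g lies in E_0, and every extended mean psi satisfies
   psi(h) = -psi(g) <= 0, i.e. psi(f) <= c.

   Together the two bounds also give the existence of the limit in theta. *)

theory Submission
  imports Defs "HOL-Real_Asymp.Real_Asymp"
begin

section \<open>Integrals on equivalence classes: additivity, positivity, the order unit\<close>

section \<open>Integrals of essentially bounded functions\<close>

lemma ess_bounded_set_integrable:
  assumes "ess_bounded f" "1 \<le> a"
  shows "set_integrable leb1 {a..b} f"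
  unfolding set_integrable_def
proof (rule integrableI_bounded_set_indicator)
  have sub: "{a..b} \<subseteq> {1..}" using assms(2) by auto
  then show "{a..b} \<in> sets leb1" by (auto simp: sets_restrict_space_iff)
  show "f \<in> borel_measurable leb1" using assms(1) by (rule ess_bounded_measurable)
  show "emeasure leb1 {a..b} < \<infinity>"
    using sub by (simp add: emeasure_restrict_space emeasure_lborel_Icc_eq)
  show "AE x in leb1. x \<in> {a..b} \<longrightarrow> norm (f x) \<le> real_of_ereal (ess_norm f)"
    using ess_bounded_AE[OF assms(1)] by eventually_elim simp
qed

lemma linf_integral_add:
  assumes "1 \<le> a"
  shows "linf_integral (f + g) a b = linf_integral f a b + linf_integral g a b"
  using assms by (transfer fixing: a b)
    (auto simp: linf_rel_def intro!: set_integral_add ess_bounded_set_integrable)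

lemma linf_integral_scaleR: "linf_integral (c *\<^sub>R f) a b = c * linf_integral f a b"
  by (transfer fixing: a b c) simp

lemma linf_integral_diff:
  assumes "1 \<le> a"
  shows "linf_integral (f - g) a b = linf_integral f a b - linf_integral g a b"
proof -
  have "f - g = f + (-1) *\<^sub>R g" by simp
  then show ?thesis using assms by (simp only: linf_integral_add linf_integral_scaleR)
qed

lemma linf_integral_nonneg:
  assumes "linf_nonneg f"
  shows "0 \<le> linf_integral f a b"
  using assms unfolding set_lebesgue_integral_def
  by (transfer fixing: a b)
    (auto simp: set_lebesgue_integral_def intro!: integral_nonneg_AE elim: eventually_mono)

lemma linf_integral_combine:
  assumes "1 \<le> a" "a \<le> b" "b \<le> c"
  shows "linf_integral f a c = linf_integral f a b + linf_integral f b c"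
proof (transfer fixing: a b c)
  fix f assume "linf_rel f f"
  then have f: "ess_bounded f" by (simp add: linf_rel_def)
  \<comment> \<open>The closed intervals share the point \<open>b\<close>, so they are disjoint only
    up to a null set.\<close>
  have "AE x in leb1. x \<noteq> b"
    by (rule AE_I[where N="{b}"]) (use assms in \<open>auto simp: emeasure_restrict_space sets_restrict_space_iff\<close>)
  then have "AE x in leb1. \<not> (x \<in> {a..b} \<and> x \<in> {b..c})"
    by eventually_elim auto
  then have "(LINT t:{a..b} \<union> {b..c}|leb1. f t) = (LINT t:{a..b}|leb1. f t) + (LINT t:{b..c}|leb1. f t)"
    using assms by (intro set_integral_Un_AE ess_bounded_set_integrable f)
      (auto simp: sets_restrict_space_iff)
  moreover have "{a..b} \<union> {b..c} = {a..c}" using assms by auto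
  ultimately show "(LINT t:{a..c}|leb1. f t) = (LINT t:{a..b}|leb1. f t) + (LINT t:{b..c}|leb1. f t)"
    by simp
qed

lift_definition linf_one :: linf is "\<lambda>x. 1"
  by (auto simp: linf_rel_def intro!: ess_boundedI[where c=1])

lemma set_integral_leb1_const:
  assumes "1 \<le> a" "a \<le> b"
  shows "(LINT t:{a..b}|leb1. (c::real)) = c * (b - a)"
proof -
  have "{a..b} \<subseteq> {1..}" using assms by auto
  then have "emeasure leb1 {a..b} = ennreal (b - a)"
    using assms by (simp add: emeasure_restrict_space)
  then show ?thesis
    using assms by (simp add: set_lebesgue_integral_def measure_def mult.commute)
qed

lemma linf_integral_one:
  assumes "1 \<le> a" "a \<le> b"
  shows "linf_integral linf_one a b = b - a"
  using assms by (transfer fixing: a b) (simp only: set_integral_leb1_const mult_1)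

lemma linf_nonneg_one: "linf_nonneg linf_one"
  by transfer simp

lemma norm_linf_one_le: "norm linf_one \<le> 1"
  by transfer (rule ess_bounded_least; auto intro!: ess_boundedI[where c=1])

text \<open>Makes \<open>linf_one\<close> an order unit: with this domination, positivity alone
  produces norm bounds, both for integrals and for extended means.\<close>

lemma linf_nonneg_norm_diff: "linf_nonneg (norm f *\<^sub>R linf_one - f)"
proof -
  have "linf_nonneg (norm f *\<^sub>R linf_one + (-1) *\<^sub>R f)"
  proof transfer
    fix f assume "linf_rel f f"
    then have "ess_bounded f" by (simp add: linf_rel_def)
    from ess_bounded_AE[OF this]
    show "AE x in leb1. 0 \<le> real_of_ereal (ess_norm f) * 1 + - 1 * f x"
      by eventually_elim auto
  qed
  then show ?thesis by simp
qed

lemma abs_linf_integral_le: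
  assumes "1 \<le> a" "a \<le> b"
  shows "\<bar>linf_integral f a b\<bar> \<le> norm f * (b - a)"
proof -
  have le: "linf_integral g a b \<le> norm g * (b - a)" for g
    using linf_integral_nonneg[OF linf_nonneg_norm_diff[of g], of a b] assms
    by (simp add: linf_integral_diff linf_integral_scaleR linf_integral_one)
  have "linf_integral (- f) a b = - linf_integral f a b"
    using linf_integral_scaleR[of "-1" f a b] by simp
  with le[of f] le[of "- f"] show ?thesis by simp
qed

section \<open>Extended means as cluster points of averages\<close>

section \<open>Functionals from averages over \<open>[x, \<theta>x]\<close>\<close>

definition avg :: "real \<Rightarrow> real \<Rightarrow> linf \<Rightarrow> real"
  where "avg \<theta> x f = 1 / (\<theta> * x - x) * linf_integral f x (\<theta> * x)"

lemma avg_add: "1 \<le> x \<Longrightarrow> avg \<theta> x (f + g) = avg \<theta> x f + avg \<theta> x g"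
  by (simp add: avg_def linf_integral_add distrib_left)

lemma avg_scaleR: "avg \<theta> x (c *\<^sub>R f) = c * avg \<theta> x f"
  by (simp add: avg_def linf_integral_scaleR)

lemma dilation_bounds:
  fixes x \<theta> :: real
  assumes "1 \<le> x" "1 < \<theta>"
  shows "x < \<theta> * x" "1 \<le> \<theta> * x"
proof -
  show "x < \<theta> * x" using assms by simp
  then show "1 \<le> \<theta> * x" using assms(1) by linarith
qed

lemma avg_nonneg: "1 \<le> x \<Longrightarrow> 1 < \<theta> \<Longrightarrow> linf_nonneg f \<Longrightarrow> 0 \<le> avg \<theta> x f"
  using dilation_bounds[of x \<theta>] by (simp add: avg_def linf_integral_nonneg)

lemma avg_one: "1 \<le> x \<Longrightarrow> 1 < \<theta> \<Longrightarrow> avg \<theta> x linf_one = 1"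
  using dilation_bounds[of x \<theta>] by (simp add: avg_def linf_integral_one)

lemma abs_avg_le:
  assumes "1 \<le> x" "1 < \<theta>"
  shows "\<bar>avg \<theta> x f\<bar> \<le> norm f"
  using abs_linf_integral_le[of x "\<theta> * x" f] dilation_bounds[OF assms] assms
  by (simp add: avg_def abs_mult divide_simps)

text \<open>The average is a combination of the means up to \<open>\<theta> * x\<close> and up to
  \<open>x\<close>, with weights that depend on \<theta> only, and both means tend to 0.\<close>

lemma avg_E0_tendsto_0:
  assumes "f \<in> E0" "1 < \<theta>"
  shows "((\<lambda>x. avg \<theta> x f) \<longlongrightarrow> 0) at_top"
proof -
  define m where "m x = 1 / x * linf_integral f 1 x" for x
  have m: "(m \<longlongrightarrow> 0) at_top"
    using assms(1) by (simp add: E0_def has_mean_def m_def[abs_def])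
  have "filterlim (\<lambda>x. \<theta> * x) at_top at_top"
    using assms(2) by (intro filterlim_tendsto_pos_mult_at_top[OF tendsto_const]) (auto intro: filterlim_ident)
  then have "((\<lambda>x. m (\<theta> * x)) \<longlongrightarrow> 0) at_top"
    by (rule filterlim_compose[OF m])
  with m have lim: "((\<lambda>x. \<theta> / (\<theta> - 1) * m (\<theta> * x) - 1 / (\<theta> - 1) * m x) \<longlongrightarrow> 0) at_top"
    using assms(2) by (auto intro!: tendsto_eq_intros)
  have "\<forall>\<^sub>F x in at_top. \<theta> / (\<theta> - 1) * m (\<theta> * x) - 1 / (\<theta> - 1) * m x = avg \<theta> x f"
    using eventually_ge_at_top[of 1]
  proof eventually_elim
    case (elim x)
    have "linf_integral f 1 (\<theta> * x) = linf_integral f 1 x + linf_integral f x (\<theta> * x)"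
      using elim assms(2) by (intro linf_integral_combine) auto
    then have "linf_integral f x (\<theta> * x) = linf_integral f 1 (\<theta> * x) - linf_integral f 1 x"
      by simp
    then show ?case using elim assms(2) unfolding avg_def m_def
      by (simp add: divide_simps) (simp add: algebra_simps)
  qed
  with lim show ?thesis by (rule Lim_transform_eventually)
qed

text \<open>The first hypothesis says that \<phi> is a cluster point of \<open>A\<close> along
  \<open>F\<close>. On the common refinement of the two filters, \<open>p\<close> tends both to
  \<open>p \<phi>\<close> and to \<open>l\<close>, and limits along a nontrivial filter are
  unique.\<close>

lemma tendsto_cluster_point:
  fixes \<phi> :: "'a::topological_space"
  assumes "inf (nhds \<phi>) (filtermap A F) \<noteq> bot" "continuous_on UNIV p"
    and "((\<lambda>x. p (A x)) \<longlongrightarrow> (l::'b::t2_space)) F"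
  shows "p \<phi> = l"
proof -
  let ?G = "inf (nhds \<phi>) (filtermap A F)"
  have "(p \<longlongrightarrow> p \<phi>) (nhds \<phi>)"
    using assms(2) by (simp add: continuous_on_def tendsto_at_iff_tendsto_nhds)
  then have "(p \<longlongrightarrow> p \<phi>) ?G" by (rule tendsto_mono[rotated]) simp
  moreover have "(p \<longlongrightarrow> l) (filtermap A F)"
    using assms(3) by (simp add: filterlim_filtermap)
  then have "(p \<longlongrightarrow> l) ?G" by (rule tendsto_mono[rotated]) simp
  ultimately show ?thesis using assms(1) by (intro tendsto_unique)
qed

text \<open>Otherwise the complement of \<open>C\<close> is a neighbourhood of \<phi> that
  \<open>A\<close> eventually avoids.\<close>

lemma cluster_point_in_closed:
  assumes "inf (nhds \<phi>) (filtermap A F) \<noteq> bot" "closed C" "\<forall>\<^sub>F x in F. A x \<in> C"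
  shows "\<phi> \<in> C"
proof (rule ccontr)
  assume "\<phi> \<notin> C"
  then have "\<forall>\<^sub>F \<psi> in nhds \<phi>. \<psi> \<notin> C"
    using assms(2) by (auto simp: eventually_nhds closed_def intro!: exI[of _ "- C"])
  moreover have "\<forall>\<^sub>F \<psi> in filtermap A F. \<psi> \<in> C"
    using assms(3) by (simp add: eventually_filtermap)
  ultimately have "\<forall>\<^sub>F \<psi> in inf (nhds \<phi>) (filtermap A F). False"
    unfolding eventually_inf by blast
  with assms(1) show False by (simp add: eventually_False)
qed

text \<open>A Banach-Alaoglu argument: the averaging functionals lie in a product of compact
  intervals, hence have a pointwise cluster point, which inherits closed conditions and
  limits.\<close>

lemma ex_extended_mean_ge:
  assumes "1 < \<theta>" "\<exists>\<^sub>F x in at_top. c < avg \<theta> x f"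
  shows "\<exists>\<psi>\<in>extended_means. c \<le> blinfun_apply \<psi> f"
proof -
  \<comment> \<open>Keeping only the points where the average exceeds \<open>c\<close> passes this
    bound on to the cluster point; the frequency hypothesis makes the filter nontrivial.\<close>
  define F where "F = inf at_top (principal {x. c < avg \<theta> x f})"
  define A where "A x g = avg \<theta> x g" for x g
  have F: "F \<noteq> bot"
    using assms(2) by (simp add: F_def trivial_limit_def eventually_inf_principal frequently_def)
  have ge1: "\<forall>\<^sub>F x in F. 1 \<le> x"
    unfolding F_def eventually_inf_principal by (auto intro: eventually_mono[OF eventually_ge_at_top[of 1]])
  \<comment> \<open>Compact by Tychonoff in the topology of pointwise convergence; the intervals
    come from \<open>abs_avg_le\<close>.\<close>
  let ?K = "PiE UNIV (\<lambda>g::linf. {- norm g..norm g})"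
  have "compactin (product_topology (\<lambda>g::linf. euclidean) UNIV) ?K"
    by (simp add: compactin_PiE)
  then have "compact ?K" by (simp add: euclidean_product_topology)
  moreover have "\<forall>\<^sub>F \<phi> in filtermap A F. \<phi> \<in> ?K"
    unfolding eventually_filtermap using ge1
  proof eventually_elim
    case (elim x)
    show ?case
      using abs_avg_le[OF elim assms(1)] by (auto simp: A_def abs_le_iff minus_le_iff)
  qed
  ultimately obtain \<phi> where "\<phi> \<in> ?K" and clust: "inf (nhds \<phi>) (filtermap A F) \<noteq> bot"
    using F unfolding compact_filter by (meson filtermap_bot_iff)
  have bound: "\<bar>\<phi> g\<bar> \<le> norm g" for g
    using \<open>\<phi> \<in> ?K\<close> by (auto simp: PiE_iff abs_le_iff minus_le_iff)
  \<comment> \<open>Linearity, positivity and normalization hold exactly at every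
    \<open>x \<ge> 1\<close> and involve finitely many coordinates, so they are closed conditions.
    Vanishing on \<open>E0\<close> holds only in the limit and is treated separately.\<close>
  have closedI: "P \<phi>" if "closed {\<phi>. P \<phi>}" "\<And>x. 1 \<le> x \<Longrightarrow> P (A x)" for P
    using cluster_point_in_closed[OF clust that(1)] eventually_mono[OF ge1] that(2) by auto
  have add: "\<phi> (g + h) = \<phi> g + \<phi> h" for g h
    by (rule closedI) (auto simp: A_def avg_add intro!: closed_Collect_eq continuous_intros)
  have scale: "\<phi> (a *\<^sub>R g) = a * \<phi> g" for a g
    by (rule closedI) (auto simp: A_def avg_scaleR intro!: closed_Collect_eq continuous_intros)
  have nonneg: "0 \<le> \<phi> g" if "linf_nonneg g" for g
    by (rule closedI)
      (auto simp: A_def avg_nonneg that assms(1) intro!: closed_Collect_le continuous_intros)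
  have one: "\<phi> linf_one = 1"
    by (rule closedI) (auto simp: A_def avg_one assms(1) intro!: closed_Collect_eq continuous_intros)
  have E0: "\<phi> g = 0" if "g \<in> E0" for g
  proof (rule tendsto_cluster_point[OF clust])
    show "continuous_on UNIV (\<lambda>\<phi>. \<phi> g)" by simp
    show "((\<lambda>x. A x g) \<longlongrightarrow> 0) F"
      using avg_E0_tendsto_0[OF that assms(1)] unfolding A_def F_def
      by (rule tendsto_mono[rotated]) simp
  qed
  have ge: "c \<le> \<phi> f"
  proof -
    have "\<phi> \<in> {\<phi>. c \<le> \<phi> f}"
      by (rule cluster_point_in_closed[OF clust])
        (auto simp: F_def A_def eventually_inf_principal intro!: closed_Collect_le continuous_intros always_eventually)
    then show ?thesis by simp
  qed
  have "bounded_linear \<phi>"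
    by (rule bounded_linear_intro[where K=1]) (use add scale bound in auto)
  then have app: "blinfun_apply (Blinfun \<phi>) = \<phi>" by (rule bounded_linear_Blinfun_apply)
  have "norm (Blinfun \<phi>) = 1"
  proof (rule antisym)
    show "norm (Blinfun \<phi>) \<le> 1"
      by (rule norm_blinfun_bound) (use bound in \<open>auto simp: app\<close>)
    have "1 \<le> norm (Blinfun \<phi>) * norm linf_one"
      using norm_blinfun[of "Blinfun \<phi>" linf_one] by (simp add: app one)
    also have "\<dots> \<le> norm (Blinfun \<phi>)"
      using norm_linf_one_le by (simp add: mult_left_le)
    finally show "1 \<le> norm (Blinfun \<phi>)" .
  qed
  with ge nonneg E0 show ?thesis
    by (intro bexI[of _ "Blinfun \<phi>"]) (auto simp: extended_means_def app)
qed

section \<open>Functions not increased by dilations, compared with their running minima\<close>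

section \<open>Running minima\<close>

text \<open>Jump from \<open>s\<close> to \<open>\<theta> * s\<close> and onwards without raising
  \<open>H\<close>, until the next jump would reach \<open>x\<close>. The remaining distance is at
  most \<open>(\<theta> - 1) * x\<close>, and the Lipschitz bound pays for it.\<close>

lemma growth_of_dilation_decreasing:
  fixes H :: "real \<Rightarrow> real"
  assumes lip: "\<And>x y. 1 \<le> x \<Longrightarrow> x \<le> y \<Longrightarrow> \<bar>H y - H x\<bar> \<le> C * (y - x)" and C: "0 \<le> C"
    and \<theta>: "1 < \<theta>" and X: "1 \<le> X" and dec: "\<And>x. X \<le> x \<Longrightarrow> H (\<theta> * x) \<le> H x"
    and s: "X \<le> s" "s \<le> x"
  shows "H x - H s \<le> C * (\<theta> - 1) * x"
proof -
  have step: "H x - H s \<le> C * (\<theta> - 1) * x" if "X \<le> s" "s \<le> x" "x \<le> \<theta> ^ n * s" for n s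
    using that
  proof (induction n arbitrary: s)
    case 0
    then show ?case using C \<theta> X by simp
  next
    case (Suc n)
    show ?case
    proof (cases "x \<le> \<theta> * s")
      case True
      have "H x - H s \<le> C * (x - s)" using lip[of s x] Suc.prems X by auto
      also have "\<dots> \<le> C * ((\<theta> - 1) * x)"
      proof (rule mult_left_mono)
        have "x - s \<le> (\<theta> - 1) * s" using True by (simp add: algebra_simps)
        also have "\<dots> \<le> (\<theta> - 1) * x" using Suc.prems \<theta> by (intro mult_left_mono) auto
        finally show "x - s \<le> (\<theta> - 1) * x" .
      qed (rule C)
      finally show ?thesis by (simp add: mult.assoc)
    next
      case False
      have "s \<le> \<theta> * s" using Suc.prems X \<theta> by simp
      then have "H x - H (\<theta> * s) \<le> C * (\<theta> - 1) * x"
        using False Suc.prems by (intro Suc.IH) (auto simp: mult_ac)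
      with dec[OF Suc.prems(1)] show ?thesis by simp
    qed
  qed
  obtain n where "x / s < \<theta> ^ n" using real_arch_pow[OF \<theta>] by blast
  then have "x \<le> \<theta> ^ n * s" using s X by (simp add: field_simps)
  with s show ?thesis by (rule step)
qed

text \<open>Sampling at integers makes the linear interpolation of the minimum, up to a constant,
  the primitive of a step function.\<close>

definition running_min :: "(real \<Rightarrow> real) \<Rightarrow> nat \<Rightarrow> real"
  where "running_min H n = Min ((\<lambda>k. H (real k)) ` {1..n})"

lemma running_min_Suc:
  assumes "1 \<le> n"
  shows "running_min H (Suc n) = min (H (real (Suc n))) (running_min H n)"
  using assms unfolding running_min_def by (simp add: atLeastAtMostSuc_conv)

lemma running_min_le: "1 \<le> n \<Longrightarrow> running_min H n \<le> H (real n)"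
  unfolding running_min_def by (intro Min_le) auto

lemma running_min_attained:
  assumes "1 \<le> n"
  obtains k where "1 \<le> k" "k \<le> n" "running_min H n = H (real k)"
proof -
  have "running_min H n \<in> (\<lambda>k. H (real k)) ` {1..n}"
    unfolding running_min_def using assms by (intro Min_in) auto
  with that show thesis by auto
qed

text \<open>The minimum drops only to a new value \<open>H (real (Suc n))\<close>; as it was at most
  \<open>H (real n)\<close> before, the drop is at most the Lipschitz bound over one unit.\<close>

lemma running_min_decrement:
  assumes lip: "\<And>x y. 1 \<le> x \<Longrightarrow> x \<le> y \<Longrightarrow> \<bar>H y - H x\<bar> \<le> C * (y - x)" and C: "0 \<le> C" and n: "1 \<le> n"
  shows "0 \<le> running_min H n - running_min H (Suc n)"
    and "running_min H n - running_min H (Suc n) \<le> C"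
proof -
  show "0 \<le> running_min H n - running_min H (Suc n)"
    using n by (simp add: running_min_Suc)
  have "\<bar>H (real (Suc n)) - H (real n)\<bar> \<le> C * (real (Suc n) - real n)"
    using n by (intro lip) auto
  then show "running_min H n - running_min H (Suc n) \<le> C"
    using running_min_le[OF n, of H] C n by (auto simp: running_min_Suc min_def)
qed

lemma floor_nat_bounds:
  fixes x :: real
  assumes "1 \<le> x"
  shows "1 \<le> nat \<lfloor>x\<rfloor>" "real (nat \<lfloor>x\<rfloor>) \<le> x" "x \<le> real (nat \<lfloor>x\<rfloor>) + 1"
  using assms by linarith+

text \<open>From below, rounding \<open>x\<close> down costs at most \<open>C\<close>. From above,
  the dilation estimate started at the minimizer costs an arbitrarily small multiple of
  \<open>x\<close>.\<close>

lemma running_min_close: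
  fixes H :: "real \<Rightarrow> real"
  assumes lip: "\<And>x y. 1 \<le> x \<Longrightarrow> x \<le> y \<Longrightarrow> \<bar>H y - H x\<bar> \<le> C * (y - x)" and C: "0 \<le> C"
    and dec: "\<And>\<delta>. 0 < \<delta> \<Longrightarrow> \<exists>\<theta>. 1 < \<theta> \<and> \<theta> < 1 + \<delta> \<and> (\<forall>\<^sub>F x in at_top. H (\<theta> * x) \<le> H x)"
  shows "((\<lambda>x. (H x - running_min H (nat \<lfloor>x\<rfloor>)) / x) \<longlongrightarrow> 0) at_top"
proof (rule tendstoI)
  fix e :: real assume e: "0 < e"
  \<comment> \<open>The choice yields \<open>C * (\<theta> - 1) \<le> e / 2\<close>;
    \<open>C + 1\<close> keeps the denominator positive when \<open>C = 0\<close>.\<close>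
  have "0 < e / (2 * (C + 1))" using e C by simp
  from dec[OF this] obtain \<theta> where \<theta>: "1 < \<theta>" "\<theta> < 1 + e / (2 * (C + 1))"
    and ev: "\<forall>\<^sub>F x in at_top. H (\<theta> * x) \<le> H x" by blast
  from ev obtain X0 where X0: "\<And>x. X0 \<le> x \<Longrightarrow> H (\<theta> * x) \<le> H x"
    by (auto simp: eventually_at_top_linorder)
  define X where "X = max 1 X0"
  have X: "1 \<le> X" "\<And>x. X \<le> x \<Longrightarrow> H (\<theta> * x) \<le> H x" using X0 by (auto simp: X_def)
  have small: "C * (\<theta> - 1) \<le> e / 2"
  proof -
    have "C * (\<theta> - 1) \<le> (C + 1) * (e / (2 * (C + 1)))"
      using \<theta> C by (intro mult_mono) auto
    also have "\<dots> = e / 2" using C by (simp add: field_simps)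
    finally show ?thesis .
  qed
  \<comment> \<open>The other half of \<open>e * x\<close> absorbs the fixed costs:
    \<open>C * X\<close> for reaching \<open>X\<close> from an earlier minimizer, \<open>C\<close>
    for rounding \<open>x\<close> down.\<close>
  have "\<forall>\<^sub>F x in at_top. C * X + C + 1 < e / 2 * x"
    using e by real_asymp
  then show "\<forall>\<^sub>F x in at_top. dist ((H x - running_min H (nat \<lfloor>x\<rfloor>)) / x) 0 < e"
    using eventually_ge_at_top[of X]
  proof eventually_elim
    case (elim x)
    define n where "n = nat \<lfloor>x\<rfloor>"
    have x1: "1 \<le> x" using elim X by simp
    have n: "1 \<le> n" "real n \<le> x" "x \<le> real n + 1"
      using floor_nat_bounds[OF x1] by (simp_all add: n_def)
    have CX: "0 \<le> C * X" using C X by simp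
    have lower: "- C \<le> H x - running_min H n"
    proof -
      have "\<bar>H x - H (real n)\<bar> \<le> C * (x - real n)" using n by (intro lip) auto
      also have "\<dots> \<le> C * 1" using n C by (intro mult_left_mono) auto
      finally show ?thesis using running_min_le[OF n(1), of H] by linarith
    qed
    obtain k where k: "1 \<le> k" "k \<le> n" "running_min H n = H (real k)"
      using running_min_attained[OF n(1)] .
    \<comment> \<open>The dilation inequality is available only from \<open>X\<close> on, while the
      minimizer \<open>k\<close> may lie before \<open>X\<close>.\<close>
    define s where "s = max X (real k)"
    have "real k \<le> x" using k n by linarith
    then have s: "X \<le> s" "s \<le> x" "real k \<le> s" using elim by (auto simp: s_def)
    have "H x - H s \<le> C * (\<theta> - 1) * x"
      by (rule growth_of_dilation_decreasing[OF lip C \<theta>(1) X s(1,2)])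
    moreover have "H s - H (real k) \<le> C * X"
    proof -
      have "\<bar>H s - H (real k)\<bar> \<le> C * (s - real k)" using k s by (intro lip) auto
      also have "\<dots> \<le> C * X" using C X by (intro mult_left_mono) (auto simp: s_def)
      finally show ?thesis by simp
    qed
    moreover have "C * (\<theta> - 1) * x \<le> e / 2 * x"
      using small x1 by (intro mult_right_mono) auto
    ultimately have "H x - running_min H n < e * x"
      using elim(1) C k(3) by simp
    moreover have "- (e * x) < H x - running_min H n"
    proof -
      have "C < e / 2 * x" using elim(1) CX C by linarith
      moreover have "e / 2 * x < e * x" using e x1 by simp
      ultimately show ?thesis using lower by linarith
    qed
    ultimately have "\<bar>H x - running_min H n\<bar> < e * x" by linarith
    then show ?case using x1 by (simp add: n_def[symmetric] abs_divide divide_less_eq)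
  qed
qed

section \<open>Corrections into \<open>E0\<close> and the upper bound for extended means\<close>

section \<open>Averages bound extended means from above\<close>

text \<open>Prescribes the slope of a primitive on each unit interval, by taking \<open>a\<close> at
  the integer part of the argument.\<close>

lemma ex_linf_step:
  fixes a :: "nat \<Rightarrow> real"
  assumes a: "\<And>n. 1 \<le> n \<Longrightarrow> 0 \<le> a n" "\<And>n. 1 \<le> n \<Longrightarrow> a n \<le> C"
  obtains g where "linf_nonneg g"
    and "\<And>n x. 1 \<le> n \<Longrightarrow> real n \<le> x \<Longrightarrow> x \<le> real n + 1 \<Longrightarrow>
      linf_integral g (real n) x = a n * (x - real n)"
proof -
  define g where "g t = a (nat \<lfloor>t\<rfloor>)" for t :: real
  have "g \<in> borel_measurable borel" unfolding g_def by measurable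
  then have meas: "g \<in> borel_measurable leb1"
    by (intro measurable_restrict_space1 measurable_completion) simp
  have AE1: "AE x in leb1. 1 \<le> x"
    by (rule AE_I2) simp
  have bdd: "ess_bounded g"
  proof (rule ess_boundedI[OF meas])
    show "AE x in leb1. \<bar>g x\<bar> \<le> C"
      using AE1 by eventually_elim (use a floor_nat_bounds(1) in \<open>auto simp: g_def\<close>)
  qed
  then have rel: "linf_rel g g" by (simp add: linf_rel_def)
  show thesis
  proof (rule that)
    show "linf_nonneg (abs_linf g)"
      unfolding linf_nonneg.abs_eq[OF rel]
      using AE1 by eventually_elim (use a(1) floor_nat_bounds(1) in \<open>auto simp: g_def\<close>)
    fix n x assume n: "1 \<le> n" "real n \<le> x" "x \<le> real n + 1"
    \<comment> \<open>For \<open>x = real n + 1\<close> the right endpoint already has integer part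
      \<open>n + 1\<close>, so this null point is excluded.\<close>
    have "AE t in leb1. t \<noteq> real n + 1"
      by (rule AE_I[where N="{real n + 1}"]) (auto simp: emeasure_restrict_space sets_restrict_space_iff)
    then have AE: "AE t in leb1. indicator {real n..x} t *\<^sub>R g t = indicator {real n..x} t *\<^sub>R a n"
    proof eventually_elim
      case (elim t)
      show ?case
      proof (cases "t \<in> {real n..x}")
        case True
        with elim n have "\<lfloor>t\<rfloor> = int n" by (simp add: floor_eq_iff)
        then show ?thesis by (simp add: g_def)
      qed simp
    qed
    have [measurable]: "indicator {real n..x} \<in> borel_measurable leb1"
      by (intro measurable_restrict_space1 borel_measurable_indicator) simp
    have "linf_integral (abs_linf g) (real n) x = (LINT t:{real n..x}|leb1. a n)"
      unfolding linf_integral.abs_eq[OF rel] set_lebesgue_integral_def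
      by (rule integral_cong_AE) (use AE meas in \<open>simp_all\<close>)
    also have "\<dots> = a n * (x - real n)"
      using n by (intro set_integral_leb1_const) auto
    finally show "linf_integral (abs_linf g) (real n) x = a n * (x - real n)" .
  qed
qed

text \<open>\<open>g\<close> gives back what the running minimum loses: the primitive of
  \<open>h + g\<close> is \<open>H\<close> minus its running minimum, up to a bounded error, and
  \<open>running_min_close\<close> makes this o(x).\<close>

lemma E0_add_step:
  fixes h :: linf
  defines "H \<equiv> linf_integral h 1"
  assumes dec: "\<And>\<delta>. 0 < \<delta> \<Longrightarrow> \<exists>\<theta>. 1 < \<theta> \<and> \<theta> < 1 + \<delta> \<and> (\<forall>\<^sub>F x in at_top. H (\<theta> * x) \<le> H x)"
  obtains g where "linf_nonneg g" "h + g \<in> E0"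
proof -
  let ?C = "norm h"
  let ?G = "running_min H"
  define a where "a n = ?G n - ?G (Suc n)" for n
  have lip: "\<bar>H y - H x\<bar> \<le> ?C * (y - x)" if "1 \<le> x" "x \<le> y" for x y
    using linf_integral_combine[of 1 x y h] abs_linf_integral_le[of x y h] that by (simp add: H_def)
  have a: "0 \<le> a n" "a n \<le> ?C" if "1 \<le> n" for n
    using running_min_decrement[of H ?C n] lip that by (auto simp: a_def)
  obtain g where g: "linf_nonneg g"
    and g_int: "\<And>n x. 1 \<le> n \<Longrightarrow> real n \<le> x \<Longrightarrow> x \<le> real n + 1 \<Longrightarrow>
      linf_integral g (real n) x = a n * (x - real n)"
    using ex_linf_step[of a ?C] a by metis
  have tele: "linf_integral g 1 (real n) = ?G 1 - ?G n" if "1 \<le> n" for n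
    using that
  proof (induction n rule: dec_induct)
    case base
    show ?case using g_int[of 1 1] by simp
  next
    case (step n)
    then show ?case
      using linf_integral_combine[of 1 "real n" "real (Suc n)" g] g_int[of n "real (Suc n)"]
      by (simp add: a_def)
  qed
  \<comment> \<open>The bounded error: the initial value of the minimum and the interpolation inside
    the last unit interval.\<close>
  define r where "r x = ?G 1 + a (nat \<lfloor>x\<rfloor>) * (x - real (nat \<lfloor>x\<rfloor>))" for x
  have "\<forall>\<^sub>F x in at_top. norm (r x / x) \<le> (\<bar>?G 1\<bar> + ?C) / x"
    using eventually_ge_at_top[of 1]
  proof eventually_elim
    case (elim x)
    note n = floor_nat_bounds[OF elim]
    have "\<bar>x - real (nat \<lfloor>x\<rfloor>)\<bar> \<le> 1" using n by linarith
    then have "\<bar>a (nat \<lfloor>x\<rfloor>) * (x - real (nat \<lfloor>x\<rfloor>))\<bar> \<le> ?C * 1"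
      unfolding abs_mult using a[OF n(1)] by (intro mult_mono) auto
    then have "\<bar>r x\<bar> \<le> \<bar>?G 1\<bar> + ?C" unfolding r_def by linarith
    then show ?case using elim by (simp add: divide_right_mono)
  qed
  moreover have "((\<lambda>x. (\<bar>?G 1\<bar> + ?C) / x) \<longlongrightarrow> 0) at_top"
    by (intro tendsto_divide_0[OF tendsto_const] filterlim_at_top_imp_at_infinity filterlim_ident)
  ultimately have "((\<lambda>x. r x / x) \<longlongrightarrow> 0) at_top" by (rule Lim_null_comparison)
  from tendsto_add[OF running_min_close[OF lip norm_ge_zero dec] this]
  have lim: "((\<lambda>x. (H x - ?G (nat \<lfloor>x\<rfloor>)) / x + r x / x) \<longlongrightarrow> 0) at_top" by simp
  have "\<forall>\<^sub>F x in at_top. (H x - ?G (nat \<lfloor>x\<rfloor>)) / x + r x / x = 1 / x * linf_integral (h + g) 1 x"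
    using eventually_ge_at_top[of 1]
  proof eventually_elim
    case (elim x)
    define n where "n = nat \<lfloor>x\<rfloor>"
    have n: "1 \<le> n" "real n \<le> x" "x \<le> real n + 1"
      using floor_nat_bounds[OF elim] by (simp_all add: n_def)
    have "linf_integral g 1 x = ?G 1 - ?G n + a n * (x - real n)"
      using linf_integral_combine[of 1 "real n" x g] tele[OF n(1)] g_int[OF n] n by simp
    then show ?case
      by (simp add: linf_integral_add H_def[symmetric] r_def n_def[symmetric] add_divide_distrib[symmetric])
  qed
  with lim have "h + g \<in> E0"
    unfolding E0_def has_mean_def by (auto intro: Lim_transform_eventually)
  with g show thesis by (rule that)
qed

text \<open>By positivity and the order unit, \<open>blinfun_apply \<psi> linf_one\<close> is itself
  a bound for the operator norm, which is 1.\<close>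

lemma extended_mean_one:
  assumes "\<psi> \<in> extended_means"
  shows "blinfun_apply \<psi> linf_one = 1"
proof (rule antisym)
  have pos: "\<And>f. linf_nonneg f \<Longrightarrow> 0 \<le> blinfun_apply \<psi> f" and norm: "norm \<psi> = 1"
    using assms by (auto simp: extended_means_def)
  show "blinfun_apply \<psi> linf_one \<le> 1"
    using norm_blinfun[of \<psi> linf_one] norm norm_linf_one_le by simp
  have le: "blinfun_apply \<psi> f \<le> blinfun_apply \<psi> linf_one * norm f" for f
    using pos[OF linf_nonneg_norm_diff[of f]]
    by (simp add: blinfun.diff_right blinfun.scaleR_right mult.commute)
  have "norm \<psi> \<le> blinfun_apply \<psi> linf_one"
  proof (rule norm_blinfun_bound)
    show "0 \<le> blinfun_apply \<psi> linf_one" by (rule pos[OF linf_nonneg_one])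
    show "norm (blinfun_apply \<psi> f) \<le> blinfun_apply \<psi> linf_one * norm f" for f
      using le[of f] le[of "- f"] by (simp add: blinfun.minus_right abs_le_iff)
  qed
  then show "1 \<le> blinfun_apply \<psi> linf_one" by (simp add: norm)
qed

text \<open>After subtracting \<open>c\<close>, the bound on the averages says that the primitive
  does not increase under dilation by \<theta>, so \<open>E0_add_step\<close> applies. Only some
  \<theta> near 1 are required, because a failure of the lower bound near 1 supplies no
  more.\<close>

lemma extended_mean_le:
  assumes \<psi>: "\<psi> \<in> extended_means"
    and avg: "\<And>\<delta>. 0 < \<delta> \<Longrightarrow> \<exists>\<theta>. 1 < \<theta> \<and> \<theta> < 1 + \<delta> \<and> (\<forall>\<^sub>F x in at_top. avg \<theta> x f \<le> c)"
  shows "blinfun_apply \<psi> f \<le> c"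
proof -
  define h where "h = f - c *\<^sub>R linf_one"
  have "\<exists>\<theta>. 1 < \<theta> \<and> \<theta> < 1 + \<delta> \<and>
      (\<forall>\<^sub>F x in at_top. linf_integral h 1 (\<theta> * x) \<le> linf_integral h 1 x)" if \<delta>: "0 < \<delta>" for \<delta>
  proof -
    from avg[OF \<delta>] obtain \<theta> where \<theta>: "1 < \<theta>" "\<theta> < 1 + \<delta>"
      and ev: "\<forall>\<^sub>F x in at_top. avg \<theta> x f \<le> c" by blast
    from ev eventually_ge_at_top[of 1]
    have "\<forall>\<^sub>F x in at_top. linf_integral h 1 (\<theta> * x) \<le> linf_integral h 1 x"
    proof eventually_elim
      case (elim x)
      note d = dilation_bounds[OF elim(2) \<theta>(1)]
      have "linf_integral h x (\<theta> * x) = linf_integral f x (\<theta> * x) - c * (\<theta> * x - x)"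
        using elim(2) d by (simp add: h_def linf_integral_diff linf_integral_scaleR linf_integral_one)
      also have "\<dots> \<le> 0"
        using elim(1) d by (simp add: avg_def pos_divide_le_eq)
      finally show ?case using linf_integral_combine[of 1 x "\<theta> * x" h] elim(2) d by simp
    qed
    with \<theta> show ?thesis by blast
  qed
  from E0_add_step[OF this] obtain g where g: "linf_nonneg g" "h + g \<in> E0" by blast
  have "blinfun_apply \<psi> (h + g) = 0" "0 \<le> blinfun_apply \<psi> g"
    using \<psi> g by (auto simp: extended_means_def)
  then have "blinfun_apply \<psi> h \<le> 0" by (simp add: blinfun.add_right)
  then show ?thesis
    by (simp add: h_def blinfun.diff_right blinfun.scaleR_right extended_mean_one[OF \<psi>])
qed

section \<open>The two inequalities and the limit in \<theta>\<close>

theorem theorem4p4: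
  fixes f :: linf
  shows "(SUP \<psi>\<in>extended_means. ereal (blinfun_apply \<psi> f)) = P_upper f"
proof -
  define S where "S = (SUP \<psi>\<in>extended_means. ereal (blinfun_apply \<psi> f))"
  define P where "P \<theta> = Limsup at_top (\<lambda>x. ereal (avg \<theta> x f))" for \<theta>
  have P_le: "P \<theta> \<le> S" if "1 < \<theta>" for \<theta>
  proof (rule ccontr)
    assume "\<not> P \<theta> \<le> S"
    \<comment> \<open>Averages above this level at arbitrarily large \<open>x\<close> would give an
      extended mean whose value at \<open>f\<close> exceeds \<open>S\<close>.\<close>
    then obtain c where c: "S < ereal c" "ereal c < P \<theta>"
      by (meson ereal_dense2 not_le)
    have "\<exists>\<^sub>F x in at_top. c < avg \<theta> x f"
    proof (rule ccontr)
      assume "\<not> (\<exists>\<^sub>F x in at_top. c < avg \<theta> x f)"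
      then have "\<forall>\<^sub>F x in at_top. ereal (avg \<theta> x f) \<le> ereal c"
        by (simp add: not_frequently not_less)
      then have "P \<theta> \<le> ereal c" unfolding P_def by (rule Limsup_bounded)
      with c(2) show False by simp
    qed
    from ex_extended_mean_ge[OF that this] obtain \<psi>
      where "\<psi> \<in> extended_means" "c \<le> blinfun_apply \<psi> f" by blast
    then have "ereal c \<le> S" unfolding S_def by (auto intro: SUP_upper2)
    with c(1) show False by simp
  qed
  \<comment> \<open>The upper half is immediate, as \<open>P_le\<close> holds for every \<theta> >
    1; only the lower half uses \<theta> near 1.\<close>
  have "(P \<longlongrightarrow> S) (at_right 1)"
  proof (rule order_tendstoI)
    fix a assume "S < a"
    then have "P \<theta> < a" if "1 < \<theta>" for \<theta>
      using P_le[OF that] by (rule le_less_trans[rotated])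
    then show "\<forall>\<^sub>F \<theta> in at_right 1. P \<theta> < a"
      unfolding eventually_at_right_field by (intro exI[of _ 2]) simp
  next
    fix a assume a: "a < S"
    show "\<forall>\<^sub>F \<theta> in at_right 1. a < P \<theta>"
    proof (rule ccontr)
      assume not: "\<not> (\<forall>\<^sub>F \<theta> in at_right 1. a < P \<theta>)"
      \<comment> \<open>The gap between \<open>a\<close> and \<open>c\<close> turns
        \<open>P \<theta> \<le> a\<close> into a strict inequality, which bounds the averages
        eventually by \<open>c\<close>.\<close>
      obtain c where c: "a < ereal c" "ereal c < S" using ereal_dense2[OF a] by auto
      have "\<exists>\<theta>. 1 < \<theta> \<and> \<theta> < 1 + \<delta> \<and> (\<forall>\<^sub>F x in at_top. avg \<theta> x f \<le> c)" if "0 < \<delta>" for \<delta>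
      proof -
        have "1 < 1 + \<delta>" using that by simp
        with not obtain \<theta> where \<theta>: "1 < \<theta>" "\<theta> < 1 + \<delta>" "\<not> a < P \<theta>"
          unfolding eventually_at_right_field by blast
        with c(1) have "P \<theta> < ereal c" by simp
        from Limsup_lessD[OF this[unfolded P_def]]
        have "\<forall>\<^sub>F x in at_top. avg \<theta> x f \<le> c" by (auto elim: eventually_mono)
        with \<theta> show ?thesis by blast
      qed
      then have "S \<le> ereal c"
        unfolding S_def by (intro SUP_least) (simp add: extended_mean_le)
      with c(2) show False by simp
    qed
  qed
  \<comment> \<open>\<open>Lim\<close> is a definite description, so its value follows only from the
    convergence just proved and uniqueness of limits.\<close>
  then have "Lim (at_right 1) P = S" by (intro tendsto_Lim) simp
  then show ?thesis by (simp add: S_def P_upper_def P_def[abs_def] avg_def)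
qed

end
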